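(* Let $F=\{1,2,3,5,8,13,\dots\}$ be the set of Fibonacci numbers. The degree of accessibility of $F$ is at most three, i.e. $doa(F)\le 3$.
   Context: $[n]:=\{1,2,\dots,n\}$, and $\mathbb{Z}^+$ is the set of positive integers. For $D\subseteq\mathbb{Z}^+$, a sequence of integers $x_1<x_2<\dots<x_k$ is called a $k$-term $D$-diffsequence if $x_{i+1}-x_i\in D$ for $1\le i\le k-1$. $\Delta(D,k;r)$ denotes the smallest positive integer $n$ such that every $r$-coloring of $[n]$ contains a monochromatic $k$-term $D$-diffsequence; if no such $n$ exists, one writes $\Delta(D,k;r)=\infty$. The set $D$ is $r$-accessible if $\Delta(D,k;r)$ exists (is finite) for all positive integers $k$. The degree of accessibility $doa(D)$ is the largest integer $r$ for which $D$ is $r$-accessible. *)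

theory Defs
  imports "HOL-Library.Extended_Nat" "HOL-Number_Theory.Fib"
begin

definition diffsequence :: "int set \<Rightarrow> nat \<Rightarrow> int list \<Rightarrow> bool" where
  "diffsequence D k xs \<longleftrightarrow>
     length xs = k \<and> sorted_wrt (<) xs \<and> (\<forall>i. Suc i < k \<longrightarrow> xs ! Suc i - xs ! i \<in> D)"

definition coloring :: "nat \<Rightarrow> nat \<Rightarrow> (int \<Rightarrow> nat) \<Rightarrow> bool" where
  "coloring r n \<chi> \<longleftrightarrow> \<chi> ` {1..int n} \<subseteq> {1..r}"

definition has_mono_diffsequence :: "int set \<Rightarrow> nat \<Rightarrow> nat \<Rightarrow> (int \<Rightarrow> nat) \<Rightarrow> bool" where
  "has_mono_diffsequence D k n \<chi> \<longleftrightarrow>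
     (\<exists>xs c. diffsequence D k xs \<and> set xs \<subseteq> {1..int n} \<and> (\<forall>x \<in> set xs. \<chi> x = c))"

(* In enat the infimum of a nonempty set is its least element, and the infimum of {} is \<infinity>. *)
definition Delta :: "int set \<Rightarrow> nat \<Rightarrow> nat \<Rightarrow> enat" where
  "Delta D k r =
     Inf {enat n | n. n \<ge> 1 \<and> (\<forall>\<chi>. coloring r n \<chi> \<longrightarrow> has_mono_diffsequence D k n \<chi>)}"

definition accessible :: "nat \<Rightarrow> int set \<Rightarrow> bool" where
  "accessible r D \<longleftrightarrow> (\<forall>k\<ge>1. Delta D k r \<noteq> \<infinity>)"

(* In enat the supremum of a nonempty bounded set is its largest element; it is \<infinity> if D is
   r-accessible for arbitrarily large r. *)
definition doa :: "int set \<Rightarrow> enat" where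
  "doa D = Sup {enat r | r. r \<ge> 1 \<and> accessible r D}"

definition fibonacci_numbers :: "int set" where
  "fibonacci_numbers = {int (fib m) | m. m \<ge> 1}"

end

theory Submission
  imports Defs
begin

text \<open>
  Four colours already defeat the Fibonacci numbers: there is a 4-colouring of the integers
  without a monochromatic 7-term diffsequence, so the set is not \<open>r\<close>-accessible for any
  \<open>r \<ge> 4\<close>.

  Place \<open>x\<close> on a circle of circumference 22 at the point \<open>x * (7 + sqrt 5)\<close>.  With
  \<open>\<psi> = (1 - sqrt 5) / 2\<close>, the conjugate of the golden ratio, one has
  \<open>F\<^sub>m * (7 + sqrt 5) = 2 * (F\<^sub>m\<^sub>+\<^sub>1 + 3 * F\<^sub>m) - 2 * \<psi> ^ m\<close>, and
  \<open>F\<^sub>m\<^sub>+\<^sub>1 + 3 * F\<^sub>m\<close> is congruent to \<open>4 ^ m\<close> modulo 11, because 4 is a root of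
  \<open>X\<^sup>2 = X + 1\<close> there.  Now 4 generates the group of nonzero squares modulo 11, and -1 is
  not a square.  Hence adding a Fibonacci number rotates the circle by almost exactly twice a
  square modulo 11, and never by almost the opposite of such a rotation.  This asymmetry is what
  four colours exploit: it is not necessary that two numbers of the same colour never
  differ by a Fibonacci number, only that such steps cannot lead round in a cycle.

  Cut the circle into 22 unit arcs.  Allowing for the error \<open>2 * \<psi> ^ m\<close>, a Fibonacci step
  advances the arc by one of the amounts in \<open>fib_jumps\<close>
  (lemma \<open>arc_add_fib\<close>).  The colours are unions of arcs on which all the steps between
  arcs of one colour respect a linear order (lemma \<open>arc_rank_increases\<close>).  A monochromatic
  diffsequence therefore visits each arc of its colour at most once, and no colour has more than
  six arcs.
\<close>

section \<open>Rotation by a Fibonacci number\<close>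

definition golden_conjugate :: real where
  "golden_conjugate = (1 - sqrt 5) / 2"

lemma golden_conjugate_square: "golden_conjugate\<^sup>2 = golden_conjugate + 1"
  by (simp add: golden_conjugate_def power2_eq_square field_simps)

lemma golden_conjugate_bounds:
  "- 62 / 100 < golden_conjugate" "golden_conjugate < - 60 / 100"
proof -
  have "sqrt 5 < 224 / 100" by (rule real_less_lsqrt) (auto simp: power2_eq_square)
  then show "- 62 / 100 < golden_conjugate" by (simp add: golden_conjugate_def)
  have "220 / 100 < sqrt 5" by (rule real_less_rsqrt) (auto simp: power2_eq_square)
  then show "golden_conjugate < - 60 / 100" by (simp add: golden_conjugate_def)
qed

definition rotation_index :: "nat \<Rightarrow> nat" where
  "rotation_index m = fib (Suc m) + 3 * fib m"

text \<open>
  Here \<open>7 + sqrt 5\<close> is \<open>2 * (\<phi> + 3)\<close> for the golden ratio \<open>\<phi> = 1 - \<psi>\<close>, and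
  \<open>F\<^sub>m * \<phi> = F\<^sub>m\<^sub>+\<^sub>1 - \<psi> ^ m\<close>: both sides of the identity satisfy the Fibonacci recurrence.
\<close>

lemma fib_times_angle:
  "real (fib m) * (7 + sqrt 5) = 2 * real (rotation_index m) - 2 * golden_conjugate ^ m"
proof (induction m rule: fib.induct)
  case (3 m)
  have "golden_conjugate ^ Suc (Suc m) = golden_conjugate ^ m * golden_conjugate\<^sup>2"
    by (simp add: power2_eq_square)
  also have "\<dots> = golden_conjugate ^ Suc m + golden_conjugate ^ m"
    unfolding golden_conjugate_square by (simp add: algebra_simps)
  finally show ?case
    using 3 by (simp add: rotation_index_def algebra_simps)
qed (simp_all add: rotation_index_def golden_conjugate_def field_simps)

lemma rotation_index_add_5: "rotation_index (m + 5) mod 11 = rotation_index m mod 11"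
proof -
  have "rotation_index (m + 5) = rotation_index m + 11 * (2 * fib (Suc m) + fib m)"
    by (simp add: rotation_index_def eval_nat_numeral)
  then show ?thesis by (metis mod_mult_self2)
qed

text \<open>The remainders are the powers of 4 modulo 11, which repeat with period 5.\<close>

lemma rotation_index_mod_11: "rotation_index m mod 11 = [1, 4, 5, 9, 3] ! (m mod 5)"
proof (induction m rule: less_induct)
  case (less m)
  show ?case
  proof (cases "m < 5")
    case True
    then have "m = 0 \<or> m = 1 \<or> m = 2 \<or> m = 3 \<or> m = 4" by auto
    moreover have "rotation_index 0 = 1" "rotation_index 1 = 4" "rotation_index 2 = 5"
      "rotation_index 3 = 9" "rotation_index 4 = 14"
      by (simp_all add: rotation_index_def eval_nat_numeral)
    ultimately show ?thesis by (elim disjE) simp_all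
  next
    case False
    then obtain l where "m = l + 5" by (metis add.commute le_Suc_ex not_less)
    with less[of l] rotation_index_add_5[of l] show ?thesis by simp
  qed
qed

text \<open>Twice the nonzero squares modulo 11, together with their two neighbours.\<close>

definition fib_jumps :: "int set" where
  "fib_jumps = {1, 2, 3, 5, 6, 7, 8, 9, 10, 11, 17, 18, 19}"

definition arc :: "int \<Rightarrow> int" where
  "arc x = \<lfloor>of_int x * (7 + sqrt 5)\<rfloor> mod 22"

text \<open>
  The error \<open>2 * \<psi> ^ m\<close> is below 1 in absolute value for \<open>m \<ge> 2\<close>, so the jump differs by
  at most 1 from twice a square.  For \<open>m = 1\<close> the error is about \<open>-1.24\<close> and the jump is
  \<open>8 + 1\<close> or \<open>8 + 2\<close>, which happen to lie next to \<open>2 * 4\<close> and at \<open>2 * 5\<close>.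
\<close>

lemma arc_add_fib:
  assumes "m \<ge> 1"
  shows "\<exists>d\<in>fib_jumps. arc (x + int (fib m)) = (arc x + d) mod 22"
proof -
  define t where "t = of_int x * (7 + sqrt 5)"
  define e where "e = - 2 * golden_conjugate ^ m"
  define \<delta> where "\<delta> = \<lfloor>t + e\<rfloor> - \<lfloor>t\<rfloor>"
  define s where "s = 2 * int ([1, 4, 5, 9, 3] ! (m mod 5))"
  have index_mod: "(2 * int (rotation_index m)) mod 22 = s mod 22"
  proof -
    have "int (rotation_index m) mod 11 = int ([1, 4, 5, 9, 3] ! (m mod 5))"
      by (metis rotation_index_mod_11 of_nat_mod of_nat_numeral)
    then have "(2 * int (rotation_index m)) mod 22 = s"
      using mod_mult_mult1[of 2 "int (rotation_index m)" 11] by (simp add: s_def)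
    then show ?thesis by (metis mod_mod_trivial)
  qed
  have "of_int (x + int (fib m)) * (7 + sqrt 5) = (t + e) + of_int (2 * int (rotation_index m))"
    using fib_times_angle[of m] by (simp add: t_def e_def algebra_simps)
  then have "arc (x + int (fib m)) = (\<lfloor>t + e\<rfloor> + 2 * int (rotation_index m)) mod 22"
    unfolding arc_def by (metis floor_add_int)
  also have "\<dots> = (\<lfloor>t\<rfloor> + (s + \<delta>)) mod 22"
    using mod_add_cong[OF refl index_mod, of "\<lfloor>t + e\<rfloor>"]
    by (simp add: \<delta>_def algebra_simps)
  also have "\<dots> = (arc x + (s + \<delta>)) mod 22"
    by (simp add: arc_def t_def mod_add_left_eq)
  finally have arc_eq: "arc (x + int (fib m)) = (arc x + (s + \<delta>)) mod 22" .
  have "s + \<delta> \<in> fib_jumps"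
  proof (cases "m = 1")
    case True
    then have "1 < e" "e < 2"
      using golden_conjugate_bounds by (auto simp: e_def)
    then have "\<delta> \<in> {1, 2}"
      unfolding \<delta>_def by (simp, linarith)
    with True show ?thesis by (auto simp: s_def fib_jumps_def)
  next
    case False
    have "\<bar>golden_conjugate\<bar> \<le> 62 / 100"
      using golden_conjugate_bounds by auto
    moreover from this False assms
    have "\<bar>golden_conjugate\<bar> ^ m \<le> \<bar>golden_conjugate\<bar> ^ 2"
      by (intro power_decreasing) auto
    ultimately have "\<bar>golden_conjugate\<bar> ^ m \<le> (62 / 100) ^ 2"
      by (meson abs_ge_zero order_trans power_mono)
    then have "\<bar>e\<bar> < 1"
      by (simp add: e_def abs_mult power_abs power2_eq_square)
    then have "\<delta> \<in> {-1, 0, 1}"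
      unfolding \<delta>_def by (simp, linarith)
    moreover have "m mod 5 \<in> {0, 1, 2, 3, 4}" by auto
    then have "s \<in> {2, 8, 10, 18, 6}"
      by (auto simp: s_def)
    ultimately show ?thesis by (auto simp: fib_jumps_def)
  qed
  with arc_eq show ?thesis by blast
qed

section \<open>The colouring\<close>

definition arc_colour :: "int \<Rightarrow> nat" where
  "arc_colour a =
     (if a \<in> {0, 1, 8, 9, 10} then 1
      else if a \<in> {16, 17, 18, 2, 3, 4} then 2
      else if a \<in> {5, 6, 7, 14, 15} then 3
      else 4)"

text \<open>
  Colour 2 must be read across the point where the numbering of the arcs restarts: its arcs
  16, 17, 18 come before 2, 3, 4.
\<close>

definition arc_rank :: "int \<Rightarrow> int" where
  "arc_rank a = (if a \<in> {2, 3, 4} then a + 22 else a)"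

lemma arc_range: "arc x \<in> {0..21}"
  by (simp add: arc_def zle_diff1_eq[symmetric])

lemma arcs_upto_21: "{0..21::int} = {0,1,2,3,4,5,6,7,8,9,10,11,12,13,14,15,16,17,18,19,20,21}"
  by code_simp

text \<open>
  Each colour consists of two blocks of two or three consecutive arcs.  A step backwards inside
  a block would be a jump by -1 or -2, that is, by 21 or 20; a step from the second block back to
  the first would be a jump by one of \<open>12, \<dots>, 16\<close>.  None of these is in \<open>fib_jumps\<close>, and
  neither is 0.  Only finitely many pairs have to be inspected.
\<close>

lemma arc_rank_increases:
  assumes "a \<in> {0..21}" "d \<in> fib_jumps" "arc_colour ((a + d) mod 22) = arc_colour a"
  shows "arc_rank a < arc_rank ((a + d) mod 22)"
proof -
  have "\<forall>a\<in>{0..21}. \<forall>d\<in>fib_jumps. arc_colour ((a + d) mod 22) = arc_colour a \<longrightarrow>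
          arc_rank a < arc_rank ((a + d) mod 22)"
    unfolding arcs_upto_21 fib_jumps_def
    by code_simp
  with assms show ?thesis by blast
qed

lemma card_arc_colour_le: "card {a \<in> {0..21}. arc_colour a = c} \<le> 6"
proof -
  have "{a \<in> {0..21}. arc_colour a = c} \<subseteq>
     (if c = 1 then {0, 1, 8, 9, 10} else if c = 2 then {16, 17, 18, 2, 3, 4}
      else if c = 3 then {5, 6, 7, 14, 15} else {11, 12, 13, 19, 20, 21})" (is "_ \<subseteq> ?S")
    unfolding arcs_upto_21 by (auto simp: arc_colour_def split: if_splits)
  then have "card {a \<in> {0..21}. arc_colour a = c} \<le> card ?S"
    by (intro card_mono) auto
  also have "\<dots> \<le> 6" by simp
  finally show ?thesis .
qed

definition circle_colouring :: "int \<Rightarrow> nat" where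
  "circle_colouring x = arc_colour (arc x)"

lemma coloring_circle_colouring: "r \<ge> 4 \<Longrightarrow> coloring r n circle_colouring"
  by (auto simp: coloring_def circle_colouring_def arc_colour_def)

text \<open>
  The rank of the arc increases strictly along a monochromatic diffsequence, so its terms lie in
  distinct arcs of a single colour, of which there are at most six.
\<close>

lemma no_mono_7_diffsequence: "\<not> has_mono_diffsequence fibonacci_numbers 7 n circle_colouring"
proof
  assume "has_mono_diffsequence fibonacci_numbers 7 n circle_colouring"
  then obtain xs c where xs: "diffsequence fibonacci_numbers 7 xs"
    and mono: "\<forall>x\<in>set xs. circle_colouring x = c"
    by (auto simp: has_mono_diffsequence_def)
  have len: "length xs = 7" using xs by (simp add: diffsequence_def)
  have step: "arc_rank (arc (xs ! i)) < arc_rank (arc (xs ! Suc i))" if i: "Suc i < 7" for i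
  proof -
    obtain m where "m \<ge> 1" "xs ! Suc i - xs ! i = int (fib m)"
      using xs i by (auto simp: diffsequence_def fibonacci_numbers_def)
    then obtain d where d: "d \<in> fib_jumps" "arc (xs ! Suc i) = (arc (xs ! i) + d) mod 22"
      using arc_add_fib[of m "xs ! i"] by (auto simp: algebra_simps)
    have "circle_colouring (xs ! Suc i) = circle_colouring (xs ! i)"
      using mono i len by simp
    then show ?thesis
      using arc_rank_increases[OF arc_range d(1)] d(2) by (simp add: circle_colouring_def)
  qed
  have "sorted_wrt (<) (map (\<lambda>x. arc_rank (arc x)) xs)"
    using step len by (subst sorted_wrt_iff_nth_Suc_transp) auto
  then have "distinct (map arc_rank (map arc xs))"
    by (simp add: strict_sorted_iff comp_def)
  then have "distinct (map arc xs)" by (metis distinct_map)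
  then have "card (arc ` set xs) = 7"
    using len by (metis distinct_card length_map set_map)
  moreover have "arc ` set xs \<subseteq> {a \<in> {0..21}. arc_colour a = c}"
    using mono arc_range by (auto simp: circle_colouring_def)
  moreover have "finite {a \<in> {0..21}. arc_colour a = c}"
    by (rule finite_subset[of _ "{0..21}"]) auto
  ultimately have "7 \<le> card {a \<in> {0..21}. arc_colour a = c}"
    by (metis card_mono)
  with card_arc_colour_le[of c] show False by simp
qed

lemma not_accessible_fibonacci_numbers:
  assumes "r \<ge> 4"
  shows "\<not> accessible r fibonacci_numbers"
proof -
  have "{enat n | n. n \<ge> 1 \<and>
          (\<forall>\<chi>. coloring r n \<chi> \<longrightarrow> has_mono_diffsequence fibonacci_numbers 7 n \<chi>)} = {}"
    using coloring_circle_colouring[OF assms] no_mono_7_diffsequence by blast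
  then have "Delta fibonacci_numbers 7 r = \<infinity>"
    unfolding Delta_def by (metis Inf_empty top_enat_def)
  moreover have "(1::nat) \<le> 7" by simp
  ultimately show ?thesis unfolding accessible_def by blast
qed

theorem theorem1: "doa fibonacci_numbers \<le> 3"
  unfolding doa_def
proof (rule Sup_least)
  fix s assume "s \<in> {enat r | r. r \<ge> 1 \<and> accessible r fibonacci_numbers}"
  then obtain r where "s = enat r" "accessible r fibonacci_numbers" by blast
  moreover from this have "r \<le> 3" using not_accessible_fibonacci_numbers[of r] by fastforce
  ultimately show "s \<le> 3" by (simp add: numeral_eq_enat)
qed

end
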